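(* Let $p$ be a prime. There is a constant $C(p)>0$ depending only on $p$ such that for every $N\ge 1$ and every finite sequence $\alpha_1,\dots,\alpha_N$ in $\mathbb{Z}_p$, its discrepancy satisfies \[ D_N \le C(p)\left(\sum_{\zeta\in \mathbb{Z}(p^\infty)\setminus\{1\}} \frac{1}{\|\zeta\|^3}\left|\frac{1}{N}\sum_{n=1}^N \zeta^{\alpha_n}\right|^2\right)^{1/4}. \]
   Context: $\mathbb{Z}_p=\{x\in\mathbb{Q}_p : |x|_p\le 1\}$ is the ring of $p$-adic integers; each $x\in\mathbb{Z}_p$ has a unique canonical expansion $x=a_0+a_1p+a_2p^2+\cdots$ with $a_i\in\{0,\dots,p-1\}$. For $a\in\mathbb{Z}_p$ and $k\ge 0$, $D(a,1/p^k)=\{x:|x-a|_p\le 1/p^k\}=a+p^k\mathbb{Z}_p$. The discrepancy of $\alpha_1,\dots,\alpha_N$ is $D_N=\sup_{a\in\mathbb{Z}_p,\,k\in\mathbb{N}}\left|\frac{|D(a,1/p^k)\cap\{\alpha_1,\dots,\alpha_N\}|}{N}-\frac1{p^k}\right|$ (the count is the number of indices $n$ with $\alpha_n$ in the disc). $\mathbb{Z}(p^\infty)$ denotes the Prüfer $p$-group of all complex $p$-power roots of unity; for $\zeta\in\mathbb{Z}(p^\infty)$, $\|\zeta\|$ is its order. If $\zeta$ has order $p^m$ and $x=a_0+a_1p+\cdots$ is the canonical expansion, then $\zeta^x:=\zeta^{a_0+a_1p+\cdots+a_{m-1}p^{m-1}}$. *)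

theory Defs
  imports
    "HOL-Analysis.Analysis"
    "HOL-Algebra.QuotRing"
    "HOL-Algebra.Multiplicative_Group"
    "HOL-Computational_Algebra.Primes"
begin

section \<open>The field of \<open>p\<close>-adic numbers\<close>

definition padic_abs :: "nat \<Rightarrow> rat \<Rightarrow> real" where
  "padic_abs p x =
     (if x = 0 then 0
      else real p powi (int (multiplicity (int p) (snd (quotient_of x)))
                        - int (multiplicity (int p) (fst (quotient_of x)))))"

definition padic_Cauchy :: "nat \<Rightarrow> (nat \<Rightarrow> rat) \<Rightarrow> bool" where
  "padic_Cauchy p f \<longleftrightarrow>
     (\<forall>\<epsilon>>0. \<exists>M. \<forall>m\<ge>M. \<forall>n\<ge>M. padic_abs p (f m - f n) < \<epsilon>)"

definition padic_Cauchy_ring :: "nat \<Rightarrow> (nat \<Rightarrow> rat) ring" where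
  "padic_Cauchy_ring p =
     \<lparr>carrier = {f. padic_Cauchy p f},
      mult = (\<lambda>f g n. f n * g n), one = (\<lambda>n. 1),
      zero = (\<lambda>n. 0), add = (\<lambda>f g n. f n + g n)\<rparr>"

definition padic_null_ideal :: "nat \<Rightarrow> (nat \<Rightarrow> rat) set" where
  "padic_null_ideal p = {f. (\<lambda>n. padic_abs p (f n)) \<longlonglongrightarrow> 0}"

text \<open>\<open>\<rat>\<^sub>p\<close> is the completion of \<open>\<rat>\<close> with respect to the \<open>p\<close>-adic absolute value:
  Cauchy sequences modulo null sequences.\<close>

definition padic_field :: "nat \<Rightarrow> (nat \<Rightarrow> rat) set ring" where
  "padic_field p = padic_Cauchy_ring p Quot padic_null_ideal p"

definition padic_of_rat :: "nat \<Rightarrow> rat \<Rightarrow> (nat \<Rightarrow> rat) set" where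
  "padic_of_rat p q = padic_null_ideal p +>\<^bsub>padic_Cauchy_ring p\<^esub> (\<lambda>n. q)"

definition padic_norm :: "nat \<Rightarrow> (nat \<Rightarrow> rat) set \<Rightarrow> real" where
  "padic_norm p x = (THE r. \<forall>f\<in>x. (\<lambda>n. padic_abs p (f n)) \<longlonglongrightarrow> r)"

definition padic_ints :: "nat \<Rightarrow> (nat \<Rightarrow> rat) set set" where
  "padic_ints p = {x \<in> carrier (padic_field p). padic_norm p x \<le> 1}"

definition padic_disc :: "nat \<Rightarrow> (nat \<Rightarrow> rat) set \<Rightarrow> real \<Rightarrow> (nat \<Rightarrow> rat) set set" where
  "padic_disc p a r = {x \<in> padic_ints p. padic_norm p (x \<ominus>\<^bsub>padic_field p\<^esub> a) \<le> r}"

definition padic_expansion :: "nat \<Rightarrow> (nat \<Rightarrow> rat) set \<Rightarrow> (nat \<Rightarrow> nat) \<Rightarrow> bool" where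
  "padic_expansion p x a \<longleftrightarrow>
     (\<forall>i. a i < p) \<and>
     (\<lambda>n. padic_norm p (x \<ominus>\<^bsub>padic_field p\<^esub>
        padic_of_rat p (of_nat (\<Sum>i<n. a i * p ^ i)))) \<longlonglongrightarrow> 0"

definition padic_digits :: "nat \<Rightarrow> (nat \<Rightarrow> rat) set \<Rightarrow> nat \<Rightarrow> nat" where
  "padic_digits p x = (THE a. padic_expansion p x a)"

definition padic_discrepancy ::
    "nat \<Rightarrow> nat \<Rightarrow> (nat \<Rightarrow> (nat \<Rightarrow> rat) set) \<Rightarrow> real" where
  "padic_discrepancy p N \<alpha> =
     (SUP (a, k) \<in> padic_ints p \<times> (UNIV :: nat set).
        \<bar>real (card {n \<in> {1..N}. \<alpha> n \<in> padic_disc p a (1 / real p ^ k)}) / real N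
          - 1 / real p ^ k\<bar>)"

section \<open>The Pruefer group\<close>

definition pruefer_group :: "nat \<Rightarrow> complex monoid" where
  "pruefer_group p =
     \<lparr>carrier = {z. \<exists>m. z ^ (p ^ m) = 1}, mult = (*), one = 1\<rparr>"

definition pruefer_order :: "nat \<Rightarrow> complex \<Rightarrow> nat" where
  "pruefer_order p z = group.ord (pruefer_group p) z"

definition pruefer_power :: "nat \<Rightarrow> complex \<Rightarrow> (nat \<Rightarrow> rat) set \<Rightarrow> complex" where
  "pruefer_power p z x =
     z ^ (\<Sum>i < (THE m. pruefer_order p z = p ^ m). padic_digits p x i * p ^ i)"

section \<open>The notions are well defined\<close>

lemma padic_abs_nonneg [simp]: "0 \<le> padic_abs p x"
  by (simp add: padic_abs_def)

lemma padic_abs_0 [simp]: "padic_abs p 0 = 0"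
  by (simp add: padic_abs_def)

lemma padic_abs_frac:
  assumes "prime p" "a \<noteq> 0" "b \<noteq> 0"
  shows "padic_abs p (of_int a / of_int b) =
    real p powi (int (multiplicity (int p) b) - int (multiplicity (int p) a))"
proof -
  obtain c d where cd: "quotient_of (of_int a / of_int b) = (c, d)"
    by fastforce
  have d: "d > 0"
    using quotient_of_denom_pos[OF cd] .
  have eq: "(of_int a / of_int b :: rat) = of_int c / of_int d"
    using quotient_of_div[OF cd] .
  then have c: "c \<noteq> 0"
    using assms d by auto
  have "(of_int (a * d) :: rat) = of_int (c * b)"
    using eq d assms by (simp add: field_simps)
  then have "a * d = c * b"
    using of_int_eq_iff by blast
  moreover have pe: "prime_elem (int p)"
    using assms by simp
  ultimately have "multiplicity (int p) a + multiplicity (int p) d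
      = multiplicity (int p) c + multiplicity (int p) b"
    using prime_elem_multiplicity_mult_distrib[OF pe, of a d]
      prime_elem_multiplicity_mult_distrib[OF pe, of c b] assms c d by simp
  then have "int (multiplicity (int p) d) - int (multiplicity (int p) c)
      = int (multiplicity (int p) b) - int (multiplicity (int p) a)"
    by linarith
  then show ?thesis
    using assms by (simp add: padic_abs_def cd)
qed

lemma padic_abs_mult:
  assumes "prime p"
  shows "padic_abs p (x * y) = padic_abs p x * padic_abs p y"
proof (cases "x = 0 \<or> y = 0")
  case False
  obtain a b where x: "x = of_int a / of_int b" "b > 0"
    by (metis quotient_of_div quotient_of_denom_pos surj_pair)
  obtain c d where y: "y = of_int c / of_int d" "d > 0"
    by (metis quotient_of_div quotient_of_denom_pos surj_pair)
  have nz: "a \<noteq> 0" "c \<noteq> 0" "real p \<noteq> 0"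
    using False x y prime_gt_0_nat[OF assms] by auto
  have xy: "x * y = of_int (a * c) / of_int (b * d)"
    by (simp add: x y)
  have pe: "prime_elem (int p)"
    using assms by simp
  show ?thesis
    unfolding xy unfolding x y
    using nz x(2) y(2) assms
    by (simp add: padic_abs_frac prime_elem_multiplicity_mult_distrib[OF pe]
        power_int_add[symmetric] algebra_simps del: of_int_mult)
qed auto

lemma padic_abs_minus:
  assumes "prime p"
  shows "padic_abs p (- x) = padic_abs p x"
proof -
  have "multiplicity (int p) (- 1) = 0"
    by (rule multiplicity_unit_right) simp
  then have "padic_abs p (- 1) = 1"
    using padic_abs_frac[OF assms, of "-1" 1] by simp
  then show ?thesis
    using padic_abs_mult[OF assms, of "-1" x] by simp
qed

lemma padic_abs_add:
  assumes "prime p"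
  shows "padic_abs p (x + y) \<le> max (padic_abs p x) (padic_abs p y)"
proof (cases "x = 0 \<or> y = 0 \<or> x + y = 0")
  case True
  then show ?thesis by (auto simp: le_max_iff_disj)
next
  case False
  obtain a b where x: "x = of_int a / of_int b" "b > 0"
    by (metis quotient_of_div quotient_of_denom_pos surj_pair)
  obtain c d where y: "y = of_int c / of_int d" "d > 0"
    by (metis quotient_of_div quotient_of_denom_pos surj_pair)
  define A C B where "A = a * d" and "C = c * b" and "B = b * d"
  have B: "B \<noteq> 0"
    using x y by (auto simp: B_def)
  have x': "x = of_int A / of_int B" and y': "y = of_int C / of_int B"
    using x y by (auto simp: A_def B_def C_def)
  have xy: "x + y = of_int (A + C) / of_int B"
    by (simp add: x' y' add_divide_distrib)
  have nz: "A \<noteq> 0" "C \<noteq> 0" "A + C \<noteq> 0"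
    using False x' y' xy by auto
  have p1: "real p \<ge> 1"
    using prime_ge_1_nat[OF assms] by simp
  have np: "\<not> is_unit (int p)"
    using prime_gt_1_nat[OF assms] by simp
  have "int p ^ min (multiplicity (int p) A) (multiplicity (int p) C) dvd A + C"
    by (intro dvd_add multiplicity_dvd') simp_all
  then have "min (multiplicity (int p) A) (multiplicity (int p) C) \<le> multiplicity (int p) (A + C)"
    by (intro multiplicity_geI) (use nz np in auto)
  then have "multiplicity (int p) A \<le> multiplicity (int p) (A + C) \<or>
      multiplicity (int p) C \<le> multiplicity (int p) (A + C)"
    by linarith
  then show ?thesis
    unfolding xy unfolding x' y' le_max_iff_disj
    using nz B by (auto simp: padic_abs_frac[OF assms] simp del: of_int_add
        intro!: power_int_increasing p1 elim!: disjE)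
qed

lemma padic_abs_triangle:
  assumes "prime p"
  shows "padic_abs p (x + y) \<le> padic_abs p x + padic_abs p y"
  using padic_abs_add[OF assms, of x y] padic_abs_nonneg[of p x] padic_abs_nonneg[of p y]
  by linarith

lemma padic_abs_diff:
  assumes "prime p"
  shows "\<bar>padic_abs p x - padic_abs p y\<bar> \<le> padic_abs p (x - y)"
  using padic_abs_triangle[OF assms, of "x - y" y] padic_abs_triangle[OF assms, of "y - x" x]
    padic_abs_minus[OF assms, of "x - y"]
  by simp

lemma padic_Cauchy_convergent:
  assumes "prime p" "padic_Cauchy p f"
  shows "convergent (\<lambda>n. padic_abs p (f n))"
proof -
  have "Cauchy (\<lambda>n. padic_abs p (f n))"
    unfolding Cauchy_def dist_real_def
    using assms(2) padic_abs_diff[OF assms(1)] unfolding padic_Cauchy_def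
    by (meson order_le_less_trans)
  then show ?thesis
    by (simp add: Cauchy_convergent_iff)
qed

lemma padic_Cauchy_add:
  assumes p: "prime p" and f: "padic_Cauchy p f" and g: "padic_Cauchy p g"
  shows "padic_Cauchy p (\<lambda>n. f n + g n)"
  unfolding padic_Cauchy_def
proof (intro allI impI)
  fix e :: real
  assume "e > 0"
  obtain M1 where M1: "\<And>m n. m \<ge> M1 \<Longrightarrow> n \<ge> M1 \<Longrightarrow> padic_abs p (f m - f n) < e"
    using f \<open>e > 0\<close> unfolding padic_Cauchy_def by metis
  obtain M2 where M2: "\<And>m n. m \<ge> M2 \<Longrightarrow> n \<ge> M2 \<Longrightarrow> padic_abs p (g m - g n) < e"
    using g \<open>e > 0\<close> unfolding padic_Cauchy_def by metis
  have "padic_abs p ((f m + g m) - (f n + g n)) < e" if "m \<ge> max M1 M2" "n \<ge> max M1 M2" for m n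
    using padic_abs_add[OF p, of "f m - f n" "g m - g n"] M1[of m n] M2[of m n] that
    by (simp add: algebra_simps)
  then show "\<exists>M. \<forall>m\<ge>M. \<forall>n\<ge>M. padic_abs p (f m + g m - (f n + g n)) < e"
    by blast
qed

lemma padic_Cauchy_mult:
  assumes p: "prime p" and f: "padic_Cauchy p f" and g: "padic_Cauchy p g"
  shows "padic_Cauchy p (\<lambda>n. f n * g n)"
  unfolding padic_Cauchy_def
proof (intro allI impI)
  fix e :: real
  assume e: "e > 0"
  have "Bseq (\<lambda>n. padic_abs p (f n))" "Bseq (\<lambda>n. padic_abs p (g n))"
    using padic_Cauchy_convergent[OF p] f g by (simp_all add: convergent_imp_Bseq)
  then obtain K L where K: "K > 0" "\<And>n. padic_abs p (f n) \<le> K"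
      and L: "L > 0" "\<And>n. padic_abs p (g n) \<le> L"
    unfolding Bseq_def by auto
  obtain M1 where M1: "\<And>m n. m \<ge> M1 \<Longrightarrow> n \<ge> M1 \<Longrightarrow> padic_abs p (f m - f n) < e / L"
    using f e L(1) unfolding padic_Cauchy_def by (metis divide_pos_pos)
  obtain M2 where M2: "\<And>m n. m \<ge> M2 \<Longrightarrow> n \<ge> M2 \<Longrightarrow> padic_abs p (g m - g n) < e / K"
    using g e K(1) unfolding padic_Cauchy_def by (metis divide_pos_pos)
  have "padic_abs p (f m * g m - f n * g n) < e" if mn: "m \<ge> max M1 M2" "n \<ge> max M1 M2" for m n
  proof -
    have "f m * g m - f n * g n = f m * (g m - g n) + (f m - f n) * g n"
      by (simp add: algebra_simps)
    then have "padic_abs p (f m * g m - f n * g n) \<le>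
        max (padic_abs p (f m) * padic_abs p (g m - g n)) (padic_abs p (f m - f n) * padic_abs p (g n))"
      using padic_abs_add[OF p, of "f m * (g m - g n)" "(f m - f n) * g n"]
      by (simp add: padic_abs_mult[OF p])
    moreover have "padic_abs p (f m) * padic_abs p (g m - g n) \<le> K * padic_abs p (g m - g n)"
      by (intro mult_right_mono K) simp
    moreover have "K * padic_abs p (g m - g n) < e"
      using M2[of m n] mn K(1) by (simp add: field_simps)
    moreover have "padic_abs p (f m - f n) * padic_abs p (g n) \<le> padic_abs p (f m - f n) * L"
      by (intro mult_left_mono L) simp
    moreover have "padic_abs p (f m - f n) * L < e"
      using M1[of m n] mn L(1) by (simp add: field_simps)
    ultimately show ?thesis by linarith
  qed
  then show "\<exists>M. \<forall>m\<ge>M. \<forall>n\<ge>M. padic_abs p (f m * g m - f n * g n) < e"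
    by blast
qed

lemma padic_Cauchy_const: "padic_Cauchy p (\<lambda>n. c)"
  by (simp add: padic_Cauchy_def)

lemma padic_Cauchy_uminus:
  assumes "prime p" "padic_Cauchy p f"
  shows "padic_Cauchy p (\<lambda>n. - f n)"
  using padic_Cauchy_mult[OF assms(1) padic_Cauchy_const[of p "-1"] assms(2)] by simp

lemma padic_null_imp_Cauchy:
  assumes p: "prime p" and f: "f \<in> padic_null_ideal p"
  shows "padic_Cauchy p f"
  unfolding padic_Cauchy_def
proof (intro allI impI)
  fix e :: real
  assume "e > 0"
  then obtain M where M: "\<And>n. n \<ge> M \<Longrightarrow> padic_abs p (f n) < e"
    using f unfolding padic_null_ideal_def LIMSEQ_iff by fastforce
  have "padic_abs p (f m - f n) < e" if "m \<ge> M" "n \<ge> M" for m n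
    using padic_abs_add[OF p, of "f m" "- f n"] M[of m] M[of n] that
    by (simp add: padic_abs_minus[OF p])
  then show "\<exists>M. \<forall>m\<ge>M. \<forall>n\<ge>M. padic_abs p (f m - f n) < e"
    by blast
qed

lemma padic_Cauchy_ring_cring:
  assumes "prime p"
  shows "cring (padic_Cauchy_ring p)"
proof (rule cringI)
  show "abelian_group (padic_Cauchy_ring p)"
  proof (rule abelian_groupI)
    fix f assume "f \<in> carrier (padic_Cauchy_ring p)"
    then show "\<exists>g\<in>carrier (padic_Cauchy_ring p). g \<oplus>\<^bsub>padic_Cauchy_ring p\<^esub> f = \<zero>\<^bsub>padic_Cauchy_ring p\<^esub>"
      using padic_Cauchy_uminus[OF assms, of f]
      by (intro bexI[of _ "\<lambda>n. - f n"]) (auto simp: padic_Cauchy_ring_def)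
  qed (auto simp: padic_Cauchy_ring_def padic_Cauchy_const padic_Cauchy_add assms add_ac)
  show "comm_monoid (padic_Cauchy_ring p)"
    by (rule comm_monoidI)
      (auto simp: padic_Cauchy_ring_def padic_Cauchy_const padic_Cauchy_mult assms mult_ac)
qed (auto simp: padic_Cauchy_ring_def distrib_right)

lemma padic_null_add:
  assumes p: "prime p" and f: "f \<in> padic_null_ideal p" and g: "g \<in> padic_null_ideal p"
  shows "(\<lambda>n. f n + g n) \<in> padic_null_ideal p"
proof -
  have "(\<lambda>n. padic_abs p (f n) + padic_abs p (g n)) \<longlonglongrightarrow> 0"
    using f g tendsto_add[of _ 0 _ _ 0] unfolding padic_null_ideal_def by fastforce
  then have "(\<lambda>n. padic_abs p (f n + g n)) \<longlonglongrightarrow> 0"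
    by (rule Lim_null_comparison[rotated])
      (simp add: padic_abs_triangle[OF p])
  then show ?thesis
    by (simp add: padic_null_ideal_def)
qed

lemma padic_null_mult:
  assumes p: "prime p" and f: "f \<in> padic_null_ideal p" and g: "padic_Cauchy p g"
  shows "(\<lambda>n. f n * g n) \<in> padic_null_ideal p"
proof -
  obtain L where "(\<lambda>n. padic_abs p (g n)) \<longlonglongrightarrow> L"
    using padic_Cauchy_convergent[OF p g] by (auto simp: convergent_def)
  then have "(\<lambda>n. padic_abs p (f n) * padic_abs p (g n)) \<longlonglongrightarrow> 0 * L"
    using f by (intro tendsto_mult) (auto simp: padic_null_ideal_def)
  then show ?thesis
    by (simp add: padic_null_ideal_def padic_abs_mult[OF p])
qed

lemma padic_Cauchy_ring_a_inv:
  assumes p: "prime p" and f: "padic_Cauchy p f"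
  shows "\<ominus>\<^bsub>padic_Cauchy_ring p\<^esub> f = (\<lambda>n. - f n)"
proof -
  interpret cring "padic_Cauchy_ring p" by (rule padic_Cauchy_ring_cring[OF p])
  show ?thesis
    by (rule minus_equality)
      (use padic_Cauchy_uminus[OF p f] f in \<open>auto simp: padic_Cauchy_ring_def\<close>)
qed

lemma padic_null_ideal_ideal:
  assumes p: "prime p"
  shows "ideal (padic_null_ideal p) (padic_Cauchy_ring p)"
proof (rule idealI)
  interpret cring "padic_Cauchy_ring p" by (rule padic_Cauchy_ring_cring[OF p])
  show "ring (padic_Cauchy_ring p)" by (rule ring_axioms)
  show "subgroup (padic_null_ideal p) (add_monoid (padic_Cauchy_ring p))"
  proof (rule add.subgroupI)
    show "padic_null_ideal p \<subseteq> carrier (padic_Cauchy_ring p)"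
      using padic_null_imp_Cauchy[OF p] by (auto simp: padic_Cauchy_ring_def)
    show "padic_null_ideal p \<noteq> {}"
      by (auto simp: padic_null_ideal_def intro: exI[of _ "\<lambda>n. 0"])
    show "\<ominus>\<^bsub>padic_Cauchy_ring p\<^esub> f \<in> padic_null_ideal p" if "f \<in> padic_null_ideal p" for f
      using that padic_null_imp_Cauchy[OF p that]
      by (simp add: padic_Cauchy_ring_a_inv[OF p])
        (simp add: padic_null_ideal_def padic_abs_minus[OF p])
    show "f \<oplus>\<^bsub>padic_Cauchy_ring p\<^esub> g \<in> padic_null_ideal p"
      if "f \<in> padic_null_ideal p" "g \<in> padic_null_ideal p" for f g
      using padic_null_add[OF p that] by (simp add: padic_Cauchy_ring_def)
  qed
  fix f g
  assume "f \<in> padic_null_ideal p" "g \<in> carrier (padic_Cauchy_ring p)"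
  then show "f \<otimes>\<^bsub>padic_Cauchy_ring p\<^esub> g \<in> padic_null_ideal p"
      "g \<otimes>\<^bsub>padic_Cauchy_ring p\<^esub> f \<in> padic_null_ideal p"
    using padic_null_mult[OF p, of f g] by (simp_all add: padic_Cauchy_ring_def mult.commute)
qed

lemma padic_field_cring:
  assumes "prime p"
  shows "cring (padic_field p)"
  unfolding padic_field_def
  by (rule ideal.quotient_is_cring[OF padic_null_ideal_ideal padic_Cauchy_ring_cring]) fact+

lemma padic_field_carrierE:
  assumes "x \<in> carrier (padic_field p)"
  obtains f where "padic_Cauchy p f" "x = padic_null_ideal p +>\<^bsub>padic_Cauchy_ring p\<^esub> f"
proof -
  have "carrier (padic_Cauchy_ring p) = {f. padic_Cauchy p f}"
    by (simp add: padic_Cauchy_ring_def)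
  then show ?thesis
    using assms that unfolding padic_field_def FactRing_simps by auto
qed

lemma padic_norm_eq:
  assumes p: "prime p" and x: "x \<in> carrier (padic_field p)" and f: "f \<in> x"
  shows "(\<lambda>n. padic_abs p (f n)) \<longlonglongrightarrow> padic_norm p x"
proof -
  obtain g where g: "padic_Cauchy p g"
      and xg: "x = padic_null_ideal p +>\<^bsub>padic_Cauchy_ring p\<^esub> g"
    using padic_field_carrierE[OF x] .
  obtain r where r: "(\<lambda>n. padic_abs p (g n)) \<longlonglongrightarrow> r"
    using padic_Cauchy_convergent[OF p g] by (auto simp: convergent_def)
  have *: "(\<lambda>n. padic_abs p (h n)) \<longlonglongrightarrow> r" if h: "h \<in> x" for h
  proof -
    obtain u where u: "u \<in> padic_null_ideal p" "h = (\<lambda>n. u n + g n)"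
      using h by (auto simp: xg a_r_coset_def r_coset_def padic_Cauchy_ring_def)
    have "(\<lambda>n. padic_abs p (h n) - padic_abs p (g n)) \<longlonglongrightarrow> 0"
    proof (rule Lim_null_comparison)
      show "\<forall>\<^sub>F n in sequentially.
          norm (padic_abs p (h n) - padic_abs p (g n)) \<le> padic_abs p (u n)"
      proof (intro always_eventually allI)
        fix n
        show "norm (padic_abs p (h n) - padic_abs p (g n)) \<le> padic_abs p (u n)"
          using padic_abs_diff[OF p, of "h n" "g n"] by (simp add: u(2))
      qed
      show "(\<lambda>n. padic_abs p (u n)) \<longlonglongrightarrow> 0"
        using u(1) by (simp add: padic_null_ideal_def)
    qed
    from tendsto_add[OF this r] show ?thesis by simp
  qed
  have "padic_norm p x = r"
    unfolding padic_norm_def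
  proof (rule the_equality)
    show "s = r" if "\<forall>h\<in>x. (\<lambda>n. padic_abs p (h n)) \<longlonglongrightarrow> s" for s
      using that * f LIMSEQ_unique by blast
  qed (use * in blast)
  then show ?thesis
    using *[OF f] by simp
qed

lemma padic_coset_carrier:
  assumes "padic_Cauchy p f"
  shows "padic_null_ideal p +>\<^bsub>padic_Cauchy_ring p\<^esub> f \<in> carrier (padic_field p)"
proof -
  have "carrier (padic_Cauchy_ring p) = {f. padic_Cauchy p f}"
    by (simp add: padic_Cauchy_ring_def)
  then show ?thesis
    using assms unfolding padic_field_def FactRing_simps by auto
qed

lemma padic_norm_coset:
  assumes p: "prime p" and f: "padic_Cauchy p f"
  shows "(\<lambda>n. padic_abs p (f n)) \<longlonglongrightarrow>
    padic_norm p (padic_null_ideal p +>\<^bsub>padic_Cauchy_ring p\<^esub> f)"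
proof -
  interpret ideal "padic_null_ideal p" "padic_Cauchy_ring p"
    by (rule padic_null_ideal_ideal[OF p])
  have "f \<in> carrier (padic_Cauchy_ring p)"
    using f by (simp add: padic_Cauchy_ring_def)
  then show ?thesis
    by (intro padic_norm_eq[OF p padic_coset_carrier[OF f]] a_rcos_self)
qed

lemma padic_coset_minus:
  assumes p: "prime p" and f: "padic_Cauchy p f" and g: "padic_Cauchy p g"
  shows "(padic_null_ideal p +>\<^bsub>padic_Cauchy_ring p\<^esub> f) \<ominus>\<^bsub>padic_field p\<^esub>
      (padic_null_ideal p +>\<^bsub>padic_Cauchy_ring p\<^esub> g) =
    padic_null_ideal p +>\<^bsub>padic_Cauchy_ring p\<^esub> (\<lambda>n. f n - g n)"
proof -
  interpret I: ideal "padic_null_ideal p" "padic_Cauchy_ring p"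
    by (rule padic_null_ideal_ideal[OF p])
  interpret h: ring_hom_ring "padic_Cauchy_ring p" "padic_field p"
      "(+>\<^bsub>padic_Cauchy_ring p\<^esub>) (padic_null_ideal p)"
    unfolding padic_field_def by (rule I.rcos_ring_hom_ring)
  have fg: "f \<in> carrier (padic_Cauchy_ring p)" "g \<in> carrier (padic_Cauchy_ring p)"
    using f g by (simp_all add: padic_Cauchy_ring_def)
  have "f \<ominus>\<^bsub>padic_Cauchy_ring p\<^esub> g = (\<lambda>n. f n - g n)"
    unfolding a_minus_def padic_Cauchy_ring_a_inv[OF p g] by (simp add: padic_Cauchy_ring_def)
  then show ?thesis
    using fg h.hom_add[OF fg(1) I.a_inv_closed[OF fg(2)]] h.hom_a_inv[OF fg(2)]
    by (simp only: a_minus_def)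
qed

lemma padic_norm_minus_of_rat:
  assumes p: "prime p" and f: "padic_Cauchy p f"
  shows "(\<lambda>n. padic_abs p (f n - q)) \<longlonglongrightarrow>
    padic_norm p ((padic_null_ideal p +>\<^bsub>padic_Cauchy_ring p\<^esub> f) \<ominus>\<^bsub>padic_field p\<^esub> padic_of_rat p q)"
  unfolding padic_of_rat_def padic_coset_minus[OF p f padic_Cauchy_const]
  using padic_Cauchy_add[OF p f padic_Cauchy_const[of p "- q"]]
  by (intro padic_norm_coset[OF p]) simp

lemma padic_norm_minus_nonneg:
  assumes p: "prime p" and x: "x \<in> carrier (padic_field p)"
  shows "0 \<le> padic_norm p (x \<ominus>\<^bsub>padic_field p\<^esub> padic_of_rat p q)"
proof -
  obtain f where f: "padic_Cauchy p f" "x = padic_null_ideal p +>\<^bsub>padic_Cauchy_ring p\<^esub> f"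
    using padic_field_carrierE[OF x] .
  show ?thesis
    unfolding f(2) by (rule LIMSEQ_le_const[OF padic_norm_minus_of_rat[OF p f(1)]]) simp
qed

lemma padic_norm_minus_ultra:
  assumes p: "prime p" and x: "x \<in> carrier (padic_field p)"
  shows "padic_norm p (x \<ominus>\<^bsub>padic_field p\<^esub> padic_of_rat p q) \<le>
      max (padic_norm p (x \<ominus>\<^bsub>padic_field p\<^esub> padic_of_rat p r)) (padic_abs p (r - q))"
    and "padic_abs p (r - q) \<le>
      max (padic_norm p (x \<ominus>\<^bsub>padic_field p\<^esub> padic_of_rat p r))
          (padic_norm p (x \<ominus>\<^bsub>padic_field p\<^esub> padic_of_rat p q))"
proof -
  obtain f where f: "padic_Cauchy p f" "x = padic_null_ideal p +>\<^bsub>padic_Cauchy_ring p\<^esub> f"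
    using padic_field_carrierE[OF x] .
  note lim = padic_norm_minus_of_rat[OF p f(1), folded f(2)]
  have "padic_abs p (f n - q) \<le> max (padic_abs p (f n - r)) (padic_abs p (r - q))" for n
    using padic_abs_add[OF p, of "f n - r" "r - q"] by simp
  then show "padic_norm p (x \<ominus>\<^bsub>padic_field p\<^esub> padic_of_rat p q) \<le>
      max (padic_norm p (x \<ominus>\<^bsub>padic_field p\<^esub> padic_of_rat p r)) (padic_abs p (r - q))"
    by (intro LIMSEQ_le[OF lim[of q] tendsto_max[OF lim[of r] tendsto_const]]) blast
  have "padic_abs p (r - q) \<le> max (padic_abs p (f n - r)) (padic_abs p (f n - q))" for n
    using padic_abs_add[OF p, of "- (f n - r)" "f n - q"] padic_abs_minus[OF p, of "f n - r"] by simp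
  then show "padic_abs p (r - q) \<le>
      max (padic_norm p (x \<ominus>\<^bsub>padic_field p\<^esub> padic_of_rat p r))
          (padic_norm p (x \<ominus>\<^bsub>padic_field p\<^esub> padic_of_rat p q))"
    by (intro LIMSEQ_le[OF tendsto_const tendsto_max[OF lim[of r] lim[of q]]]) blast
qed

lemma padic_abs_le_iff:
  assumes p: "prime p" and a: "a \<noteq> 0" and b: "b \<noteq> 0"
  shows "padic_abs p (of_int a / of_int b) \<le> 1 / real p ^ k \<longleftrightarrow>
    multiplicity (int p) b + k \<le> multiplicity (int p) a"
proof -
  have p1: "real p > 1"
    using prime_gt_1_nat[OF p] by simp
  have "1 / real p ^ k = real p powi (- int k)"
    by (simp add: power_int_minus field_simps)
  then have "padic_abs p (of_int a / of_int b) \<le> 1 / real p ^ k \<longleftrightarrow>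
      int (multiplicity (int p) b) - int (multiplicity (int p) a) \<le> - int k"
    unfolding padic_abs_frac[OF p a b]
    by (metis linorder_not_le order_less_imp_le p1 power_int_increasing power_int_strict_increasing)
  then show ?thesis by linarith
qed

lemma padic_abs_int_le_iff:
  assumes p: "prime p"
  shows "padic_abs p (of_int a) \<le> 1 / real p ^ k \<longleftrightarrow> int p ^ k dvd a"
proof (cases "a = 0")
  case False
  have "\<not> is_unit (int p)"
    using prime_gt_1_nat[OF p] by simp
  then show ?thesis
    using padic_abs_le_iff[OF p False, of 1 k] False by (simp add: power_dvd_iff_le_multiplicity)
qed auto

lemma padic_rat_approx:
  assumes p: "prime p" and x: "padic_abs p x \<le> 1"
  obtains t :: nat where "t < p ^ k" "padic_abs p (x - of_nat t) \<le> 1 / real p ^ k"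
proof (cases "x = 0")
  case True
  then show ?thesis
    using that[of 0] prime_gt_0_nat[OF p] by simp
next
  case False
  obtain a b where ab: "quotient_of x = (a, b)"
    by fastforce
  have b: "b > 0" and co: "coprime a b" and xab: "x = of_int a / of_int b"
    using quotient_of_denom_pos[OF ab] quotient_of_coprime[OF ab] quotient_of_div[OF ab] by auto
  have a: "a \<noteq> 0"
    using False xab by auto
  have pp: "prime (int p)"
    using p by simp
  have "multiplicity (int p) b \<le> multiplicity (int p) a"
    using padic_abs_le_iff[OF p a, of b 0] b x xab by simp
  moreover have "\<not> (int p dvd a \<and> int p dvd b)"
    using co pp by (meson coprime_common_divisor not_prime_unit)
  ultimately have ndvd: "\<not> int p dvd b"
    using a b pp prime_multiplicity_gt_zero_iff[of "int p" a]
      prime_multiplicity_gt_zero_iff[of "int p" b]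
    by (auto simp: prime_imp_prime_elem)
  then have mb: "multiplicity (int p) b = 0"
    by (rule not_dvd_imp_multiplicity_0)
  from ndvd have cop: "coprime b (int p ^ k)"
    using prime_imp_coprime[OF pp, of b] by (simp add: coprime_commute)
  then obtain u v where uv: "u * b + v * int p ^ k = 1"
    by (metis bezout_int coprime_imp_gcd_eq_1)
  define t where "t = nat ((a * u) mod int p ^ k)"
  have ppos: "int p ^ k > 0"
    using prime_gt_0_nat[OF p] by simp
  have t: "int t = (a * u) mod int p ^ k"
    using ppos by (simp add: t_def)
  have "int t < int (p ^ k)"
    using t ppos by simp
  then have tlt: "t < p ^ k"
    by linarith
  have "int p ^ k dvd a * u - int t"
    unfolding t by (simp add: minus_mod_eq_mult_div)
  then have "int p ^ k dvd (a * u - int t) * b"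
    by simp
  moreover have "(a * u - int t) * b + a * v * int p ^ k = a * (u * b + v * int p ^ k) - int t * b"
    by (simp add: algebra_simps)
  ultimately have dvd: "int p ^ k dvd a - int t * b"
    unfolding uv by (metis dvd_add dvd_triv_right mult.right_neutral)
  have "padic_abs p (of_int (a - int t * b) / of_int b) \<le> 1 / real p ^ k"
  proof (cases "a - int t * b = 0")
    case False
    have "\<not> is_unit (int p)"
      using prime_gt_1_nat[OF p] by simp
    then show ?thesis
      using padic_abs_le_iff[OF p False, of b k] b dvd False mb
      by (simp add: power_dvd_iff_le_multiplicity)
  qed simp
  moreover have "x - of_nat t = of_int (a - int t * b) / of_int b"
    using b by (simp add: xab field_simps)
  ultimately show ?thesis
    using that[OF tlt] by simp
qed

lemma padic_ints_approx:
  assumes p: "prime p" and x: "x \<in> padic_ints p"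
  obtains t :: nat where "t < p ^ k"
    "padic_norm p (x \<ominus>\<^bsub>padic_field p\<^esub> padic_of_rat p (of_nat t)) \<le> 1 / real p ^ k"
proof -
  have xc: "x \<in> carrier (padic_field p)" and x1: "padic_norm p x \<le> 1"
    using x by (auto simp: padic_ints_def)
  obtain f where f: "padic_Cauchy p f" "x = padic_null_ideal p +>\<^bsub>padic_Cauchy_ring p\<^esub> f"
    using padic_field_carrierE[OF xc] .
  have p1: "real p > 1"
    using prime_gt_1_nat[OF p] by simp
  have "\<forall>\<^sub>F n in sequentially. padic_abs p (f n) < real p"
    using order_tendstoD(2)[OF padic_norm_coset[OF p f(1)]] x1 p1 f(2) by simp
  then obtain M1 where M1: "\<And>n. n \<ge> M1 \<Longrightarrow> padic_abs p (f n) < real p"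
    by (auto simp: eventually_sequentially)
  obtain M2 where M2: "\<And>m n. m \<ge> M2 \<Longrightarrow> n \<ge> M2 \<Longrightarrow> padic_abs p (f m - f n) < 1 / real p ^ k"
    using f(1) p1 unfolding padic_Cauchy_def
    by (metis less_trans zero_less_divide_1_iff zero_less_one zero_less_power)
  define M where "M = max M1 M2"
  have "padic_abs p (f M) \<le> 1"
  proof (cases "f M = 0")
    case False
    define e where "e = int (multiplicity (int p) (snd (quotient_of (f M))))
      - int (multiplicity (int p) (fst (quotient_of (f M))))"
    have e: "padic_abs p (f M) = real p powi e"
      using False by (simp add: padic_abs_def e_def)
    have "e < 1"
    proof (rule ccontr)
      assume "\<not> e < 1"
      then have "real p powi 1 \<le> real p powi e"
        using p1 by (intro power_int_increasing) auto
      then show False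
        using M1[of M] e by (simp add: M_def)
    qed
    then have "real p powi e \<le> real p powi 0"
      using p1 by (intro power_int_increasing) auto
    then show ?thesis
      by (simp add: e)
  qed simp
  then obtain t where t: "t < p ^ k" "padic_abs p (f M - of_nat t) \<le> 1 / real p ^ k"
    using padic_rat_approx[OF p] by blast
  have "padic_abs p (f n - of_nat t) \<le> 1 / real p ^ k" if "n \<ge> M" for n
    using padic_abs_add[OF p, of "f n - f M" "f M - of_nat t"] M2[of n M] t(2) that
    by (simp add: M_def)
  then have "padic_norm p (x \<ominus>\<^bsub>padic_field p\<^esub> padic_of_rat p (of_nat t)) \<le> 1 / real p ^ k"
    unfolding f(2) by (intro LIMSEQ_le_const2[OF padic_norm_minus_of_rat[OF p f(1)]]) blast
  then show ?thesis
    using that t(1) by blast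
qed

lemma padic_approx_unique:
  assumes p: "prime p" and x: "x \<in> carrier (padic_field p)"
    and s: "padic_norm p (x \<ominus>\<^bsub>padic_field p\<^esub> padic_of_rat p (of_nat s)) \<le> 1 / real p ^ k"
    and t: "padic_norm p (x \<ominus>\<^bsub>padic_field p\<^esub> padic_of_rat p (of_nat t)) \<le> 1 / real p ^ k"
  shows "s mod p ^ k = t mod p ^ k"
proof -
  have "padic_abs p (of_nat s - of_nat t) \<le> 1 / real p ^ k"
    using padic_norm_minus_ultra(2)[OF p x, of "of_nat s" "of_nat t"] s t by linarith
  then have "padic_abs p (of_int (int s - int t)) \<le> 1 / real p ^ k"
    by simp
  then have "int p ^ k dvd int s - int t"
    using padic_abs_int_le_iff[OF p] by blast
  then have "int s mod int (p ^ k) = int t mod int (p ^ k)"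
    by (simp add: mod_eq_dvd_iff)
  then show ?thesis
    by (metis of_nat_eq_iff zmod_int)
qed

lemma digit_sum_less:
  fixes a :: "nat \<Rightarrow> nat"
  assumes "\<And>i. a i < p"
  shows "(\<Sum>i<n. a i * p ^ i) < p ^ n"
proof (induction n)
  case (Suc n)
  have "(\<Sum>i<Suc n. a i * p ^ i) < (a n + 1) * p ^ n"
    using Suc by simp
  also have "\<dots> \<le> p * p ^ n"
    using assms[of n] by (intro mult_right_mono) auto
  finally show ?case by simp
qed simp

lemma padic_expansion_partial:
  assumes p: "prime p" and x: "x \<in> carrier (padic_field p)" and a: "padic_expansion p x a"
  shows "padic_norm p (x \<ominus>\<^bsub>padic_field p\<^esub>
    padic_of_rat p (of_nat (\<Sum>i<n. a i * p ^ i))) \<le> 1 / real p ^ n"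
proof -
  let ?S = "\<lambda>n. \<Sum>i<n. a i * p ^ i"
  have "1 / real p ^ n > 0"
    using prime_gt_0_nat[OF p] by simp
  then have "\<forall>\<^sub>F N in sequentially.
      padic_norm p (x \<ominus>\<^bsub>padic_field p\<^esub> padic_of_rat p (of_nat (?S N))) < 1 / real p ^ n"
    using a order_tendstoD(2) unfolding padic_expansion_def by blast
  then obtain N0 where N0: "\<And>N. N \<ge> N0 \<Longrightarrow>
      padic_norm p (x \<ominus>\<^bsub>padic_field p\<^esub> padic_of_rat p (of_nat (?S N))) < 1 / real p ^ n"
    by (auto simp: eventually_sequentially)
  define N where "N = max N0 n"
  have "?S N = ?S n + (\<Sum>i\<in>{n..<N}. a i * p ^ i)"
    by (metis N_def lessThan_atLeast0 max.cobounded2 sum.atLeastLessThan_concat zero_le)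
  moreover have "p ^ n dvd (\<Sum>i\<in>{n..<N}. a i * p ^ i)"
    by (intro dvd_sum) (auto intro!: dvd_mult le_imp_power_dvd)
  ultimately obtain c where c: "?S N = ?S n + p ^ n * c"
    by (auto elim!: dvdE)
  have "padic_abs p (of_int (int (p ^ n * c))) \<le> 1 / real p ^ n"
    unfolding padic_abs_int_le_iff[OF p] by simp
  then have "padic_abs p (of_nat (?S N) - of_nat (?S n)) \<le> 1 / real p ^ n"
    unfolding c by simp
  then show ?thesis
    using padic_norm_minus_ultra(1)[OF p x, of "of_nat (?S n)" "of_nat (?S N)"] N0[of N]
    by (auto simp: N_def)
qed

lemma padic_expansion_ex1:
  assumes p: "prime p" and x: "x \<in> padic_ints p"
  shows "\<exists>!a. padic_expansion p x a"
proof (rule ex_ex1I)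
  have xc: "x \<in> carrier (padic_field p)"
    using x by (simp add: padic_ints_def)
  have p1: "p > 1"
    using prime_gt_1_nat[OF p] .
  show "a = b" if a: "padic_expansion p x a" and b: "padic_expansion p x b" for a b
  proof
    fix i
    have eq: "(\<Sum>i<n. a i * p ^ i) = (\<Sum>i<n. b i * p ^ i)" for n
      using padic_approx_unique[OF p xc padic_expansion_partial[OF p xc a, of n]
          padic_expansion_partial[OF p xc b, of n]]
        digit_sum_less[of a p n] digit_sum_less[of b p n] a b
      by (simp add: padic_expansion_def)
    from eq[of "Suc i"] eq[of i] show "a i = b i"
      using p1 by simp
  qed
  have "\<forall>k. \<exists>t<p ^ k. padic_norm p (x \<ominus>\<^bsub>padic_field p\<^esub> padic_of_rat p (of_nat t)) \<le> 1 / real p ^ k"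
    using padic_ints_approx[OF p x] by metis
  then obtain t where t: "\<And>k. t k < p ^ k"
      "\<And>k. padic_norm p (x \<ominus>\<^bsub>padic_field p\<^esub> padic_of_rat p (of_nat (t k))) \<le> 1 / real p ^ k"
    by metis
  have step: "t (Suc k) mod p ^ k = t k" for k
  proof -
    have "1 / real p ^ Suc k \<le> 1 / real p ^ k"
      using p1 by (intro divide_left_mono power_increasing) auto
    then have "t (Suc k) mod p ^ k = t k mod p ^ k"
      using t(2)[of "Suc k"] t(2)[of k] by (intro padic_approx_unique[OF p xc]) auto
    then show ?thesis
      using t(1)[of k] by simp
  qed
  define d where "d i = t (Suc i) div p ^ i" for i
  have d: "d i < p" for i
    using t(1)[of "Suc i"] p1 by (simp add: d_def less_mult_imp_div_less)
  have S: "(\<Sum>i<n. d i * p ^ i) = t n" for n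
  proof (induction n)
    case 0
    show ?case using t(1)[of 0] by simp
  next
    case (Suc n)
    have "t (Suc n) = d n * p ^ n + t (Suc n) mod p ^ n"
      unfolding d_def by (rule div_mult_mod_eq[symmetric])
    then show ?case
      using Suc step[of n] by simp
  qed
  have "(\<lambda>n. 1 / real p ^ n) \<longlonglongrightarrow> 0"
    using p1 LIMSEQ_realpow_zero[of "1 / real p"] by (simp add: power_one_over)
  then have "(\<lambda>n. padic_norm p (x \<ominus>\<^bsub>padic_field p\<^esub> padic_of_rat p (of_nat (t n)))) \<longlonglongrightarrow> 0"
    by (rule Lim_null_comparison[rotated])
      (use t(2) padic_norm_minus_nonneg[OF p xc] in auto)
  then show "\<exists>a. padic_expansion p x a"
    unfolding padic_expansion_def using d S by (intro exI[of _ d]) simp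
qed

lemma pruefer_group_group:
  assumes "prime p"
  shows "group (pruefer_group p)"
proof (rule groupI)
  fix x y
  assume "x \<in> carrier (pruefer_group p)" "y \<in> carrier (pruefer_group p)"
  then obtain m n where mn: "x ^ (p ^ m) = 1" "y ^ (p ^ n) = 1"
    by (auto simp: pruefer_group_def)
  have "x ^ (p ^ (m + n)) = 1"
    by (simp only: power_add power_mult mn power_one)
  moreover have "y ^ (p ^ (m + n)) = 1"
    by (simp only: add.commute[of m n] power_add power_mult mn power_one)
  ultimately have "(x * y) ^ (p ^ (m + n)) = 1"
    by (simp add: power_mult_distrib)
  then show "x \<otimes>\<^bsub>pruefer_group p\<^esub> y \<in> carrier (pruefer_group p)"
    by (auto simp: pruefer_group_def)
next
  fix x
  assume "x \<in> carrier (pruefer_group p)"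
  then obtain m where m: "x ^ (p ^ m) = 1"
    by (auto simp: pruefer_group_def)
  have "x \<noteq> 0"
    using m assms by (auto simp: power_0_left prime_gt_0_nat split: if_splits)
  moreover have "inverse x ^ (p ^ m) = 1"
    using m by (simp add: power_inverse)
  ultimately show "\<exists>y\<in>carrier (pruefer_group p). y \<otimes>\<^bsub>pruefer_group p\<^esub> x = \<one>\<^bsub>pruefer_group p\<^esub>"
    by (intro bexI[of _ "inverse x"]) (auto simp: pruefer_group_def)
qed (auto simp: pruefer_group_def)

end

theory Submission
  imports Defs
begin

text \<open>
  Let \<open>T\<close> be the sum on the right and \<open>S \<zeta>\<close> the normalised exponential sum. Fourier inversion on
  \<open>\<int>/p\<^sup>k\<close> expresses \<open>p\<^sup>k\<close> times the local discrepancy of a disc of radius \<open>1/p\<^sup>k\<close> as a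
  combination of the \<open>S \<zeta>\<close> over \<open>\<zeta> \<noteq> 1\<close> with \<open>\<zeta> ^ (p\<^sup>k) = 1\<close>, with coefficients of modulus one. By Cauchy-Schwarz
  and \<open>\<parallel>\<zeta>\<parallel> \<le> p\<^sup>k\<close>, the local discrepancy is at most \<open>p\<^sup>k \<surd>T\<close>. This is good for discs of radius at
  least about \<open>T\<close> to the power \<open>1/4\<close>; a smaller disc is compared with a disc of that radius
  containing it. So \<open>C = p + 1\<close> works.
\<close>

section \<open>Residues of \<open>p\<close>-adic integers\<close>

text \<open>For a p-adic integer this is its reduction modulo \<open>p ^ k\<close>. It is built from
  the digits because \<open>pruefer_power\<close> uses the same kind of truncated sum as its
  exponent.\<close>

definition padic_residue :: "nat \<Rightarrow> nat \<Rightarrow> (nat \<Rightarrow> rat) set \<Rightarrow> nat" where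
  "padic_residue p k x = (\<Sum>i<k. padic_digits p x i * p ^ i)"

lemma padic_digits_expansion:
  assumes "prime p" "x \<in> padic_ints p"
  shows "padic_expansion p x (padic_digits p x)"
  unfolding padic_digits_def by (rule theI'[OF padic_expansion_ex1[OF assms]])

lemma padic_residue_less:
  assumes "prime p" "x \<in> padic_ints p"
  shows "padic_residue p k x < p ^ k"
  unfolding padic_residue_def
  using padic_digits_expansion[OF assms] by (intro digit_sum_less) (simp add: padic_expansion_def)

lemma padic_residue_approx:
  assumes "prime p" "x \<in> padic_ints p"
  shows "padic_norm p (x \<ominus>\<^bsub>padic_field p\<^esub> padic_of_rat p (of_nat (padic_residue p k x)))
    \<le> 1 / real p ^ k"
  unfolding padic_residue_def
  using assms
  by (intro padic_expansion_partial padic_digits_expansion) (auto simp: padic_ints_def)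

text \<open>The digits from position \<open>m\<close> on contribute only multiples of
  \<open>p ^ m\<close>.\<close>

lemma padic_residue_cong:
  assumes "m \<le> k"
  shows "\<exists>c. padic_residue p k x = padic_residue p m x + p ^ m * c"
proof -
  have "padic_residue p k x = padic_residue p m x + (\<Sum>i\<in>{m..<k}. padic_digits p x i * p ^ i)"
    unfolding padic_residue_def
    by (metis assms lessThan_atLeast0 sum.atLeastLessThan_concat zero_le)
  moreover have "p ^ m dvd (\<Sum>i\<in>{m..<k}. padic_digits p x i * p ^ i)"
    by (intro dvd_sum) (auto intro!: dvd_mult le_imp_power_dvd)
  ultimately show ?thesis
    by (auto elim!: dvdE)
qed

text \<open>In terms of discs: those about one centre are nested. The comparison of a small disc
  with a larger one rests on this.\<close>

lemma padic_residue_eq_mono: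
  assumes "prime p" "x \<in> padic_ints p" "y \<in> padic_ints p" "m \<le> k"
    and "padic_residue p k x = padic_residue p k y"
  shows "padic_residue p m x = padic_residue p m y"
proof -
  obtain c d where "padic_residue p k x = padic_residue p m x + p ^ m * c"
    "padic_residue p k y = padic_residue p m y + p ^ m * d"
    using padic_residue_cong[OF assms(4)] by metis
  then have "padic_residue p m x mod p ^ m = padic_residue p m y mod p ^ m"
    using assms(5) by (metis mod_mult_self2)
  then show ?thesis
    using padic_residue_less[OF assms(1,2), of m] padic_residue_less[OF assms(1,3), of m] by simp
qed

text \<open>Trades discs for congruences, the form in which Fourier inversion on a finite cyclic
  group applies. Each direction is the ultrametric inequality for representing Cauchy sequences,
  passed to the limit.\<close>

lemma padic_disc_iff_residue:
  assumes p: "prime p" and x: "x \<in> padic_ints p" and a: "a \<in> padic_ints p"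
  shows "x \<in> padic_disc p a (1 / real p ^ k) \<longleftrightarrow> padic_residue p k x = padic_residue p k a"
proof -
  let ?s = "padic_residue p k x" and ?t = "padic_residue p k a"
  have xc: "x \<in> carrier (padic_field p)" and ac: "a \<in> carrier (padic_field p)"
    using x a by (auto simp: padic_ints_def)
  obtain f where f: "padic_Cauchy p f" "x = padic_null_ideal p +>\<^bsub>padic_Cauchy_ring p\<^esub> f"
    using padic_field_carrierE[OF xc] .
  obtain g where g: "padic_Cauchy p g" "a = padic_null_ideal p +>\<^bsub>padic_Cauchy_ring p\<^esub> g"
    using padic_field_carrierE[OF ac] .
  have "padic_Cauchy p (\<lambda>n. f n - g n)"
    using padic_Cauchy_add[OF p f(1) padic_Cauchy_uminus[OF p g(1)]] by simp
  then have lim: "(\<lambda>n. padic_abs p (f n - g n)) \<longlonglongrightarrow> padic_norm p (x \<ominus>\<^bsub>padic_field p\<^esub> a)"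
    unfolding f(2) g(2) padic_coset_minus[OF p f(1) g(1)] by (rule padic_norm_coset[OF p])
  note limf = padic_norm_minus_of_rat[OF p f(1), folded f(2)]
  note limg = padic_norm_minus_of_rat[OF p g(1), folded g(2)]
  note approx = padic_residue_approx[OF p x, of k] padic_residue_approx[OF p a, of k]
  have "padic_norm p (x \<ominus>\<^bsub>padic_field p\<^esub> a) \<le> 1 / real p ^ k \<longleftrightarrow> ?s = ?t"
  proof
    assume st: "?s = ?t"
    have "padic_abs p (f n - g n) \<le> max (padic_abs p (f n - of_nat ?s)) (padic_abs p (g n - of_nat ?t))"
      for n
      using padic_abs_add[OF p, of "f n - of_nat ?s" "- (g n - of_nat ?t)"]
      unfolding padic_abs_minus[OF p] st by simp
    then have "padic_norm p (x \<ominus>\<^bsub>padic_field p\<^esub> a) \<le>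
        max (padic_norm p (x \<ominus>\<^bsub>padic_field p\<^esub> padic_of_rat p (of_nat ?s)))
          (padic_norm p (a \<ominus>\<^bsub>padic_field p\<^esub> padic_of_rat p (of_nat ?t)))"
      by (intro LIMSEQ_le[OF lim tendsto_max[OF limf limg]]) blast
    then show "padic_norm p (x \<ominus>\<^bsub>padic_field p\<^esub> a) \<le> 1 / real p ^ k"
      using approx by linarith
  next
    assume xa: "padic_norm p (x \<ominus>\<^bsub>padic_field p\<^esub> a) \<le> 1 / real p ^ k"
    have "padic_abs p (f n - of_nat ?t) \<le> max (padic_abs p (f n - g n)) (padic_abs p (g n - of_nat ?t))"
      for n
      using padic_abs_add[OF p, of "f n - g n" "g n - of_nat ?t"] by simp
    then have "padic_norm p (x \<ominus>\<^bsub>padic_field p\<^esub> padic_of_rat p (of_nat ?t)) \<le>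
        max (padic_norm p (x \<ominus>\<^bsub>padic_field p\<^esub> a))
          (padic_norm p (a \<ominus>\<^bsub>padic_field p\<^esub> padic_of_rat p (of_nat ?t)))"
      by (intro LIMSEQ_le[OF limf tendsto_max[OF lim limg]]) blast
    then have "padic_norm p (x \<ominus>\<^bsub>padic_field p\<^esub> padic_of_rat p (of_nat ?t)) \<le> 1 / real p ^ k"
      using approx(2) xa by linarith
    \<comment> \<open>Both \<open>?s\<close> and \<open>?t\<close> now approximate \<open>x\<close>
      to within \<open>1 / p ^ k\<close>.\<close>
    then have "?s mod p ^ k = ?t mod p ^ k"
      using approx(1) by (intro padic_approx_unique[OF p xc])
    then show "?s = ?t"
      using padic_residue_less[OF p x, of k] padic_residue_less[OF p a, of k] by simp
  qed
  then show ?thesis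
    using x by (simp add: padic_disc_def)
qed

section \<open>Roots of unity\<close>

text \<open>If \<open>q\<close> does not divide \<open>s\<close>, multiplication by a primitive root
  \<open>w\<close> permutes the roots, so the sum equals \<open>w ^ s\<close> times itself; since
  \<open>w ^ s\<close> is not 1, it vanishes.\<close>

lemma sum_roots_unity_power:
  fixes q s :: nat
  assumes q: "q > 0"
  shows "(\<Sum>z | z ^ q = 1. z ^ s) = (if q dvd s then of_nat q else (0::complex))"
proof (cases "q dvd s")
  case True
  then have "z ^ s = 1" if "z ^ q = 1" for z :: complex
    using that by (auto simp: power_mult elim!: dvdE)
  then show ?thesis
    using True q by (simp add: card_roots_unity_eq)
next
  case False
  define w where "w = cis (2 * pi / real q)"
  have wpow: "w ^ j = cis (2 * pi * real j / real q)" for j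
    unfolding w_def Complex.DeMoivre by (simp add: mult_ac)
  have wq: "w ^ q = 1"
    using q by (simp add: wpow)
  have "inj_on (\<lambda>j. cis (2 * pi * real j / real q)) {..<q}"
    using Complex.bij_betw_roots_unity[OF q] by (rule bij_betw_imp_inj_on)
  \<comment> \<open>Injectivity of the enumeration of the roots makes \<open>w\<close> primitive: no
    positive exponent below \<open>q\<close> gives 1.\<close>
  then have "w ^ (s mod q) = w ^ 0 \<longrightarrow> s mod q = 0"
    using q unfolding wpow inj_on_def by simp
  moreover have "w ^ s = w ^ (s mod q)"
    by (metis wq mod_mult_div_eq mult.right_neutral power_add power_mult power_one)
  ultimately have ws: "w ^ s \<noteq> 1"
    using False by (metis dvd_eq_mod_eq_0 power_0)
  have w0: "w \<noteq> 0"
    by (simp add: w_def)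
  have "(\<Sum>z | z ^ q = 1. z ^ s) = (\<Sum>z | z ^ q = 1. (w * z) ^ s)"
    by (rule sum.reindex_bij_witness[of _ "\<lambda>z. w * z" "\<lambda>z. z / w"])
      (use w0 wq in \<open>auto simp: power_mult_distrib power_divide\<close>)
  also have "\<dots> = w ^ s * (\<Sum>z | z ^ q = 1. z ^ s)"
    by (simp add: power_mult_distrib sum_distrib_left)
  finally show ?thesis
    using False ws by auto
qed

section \<open>Orders and p-adic powers in the Pruefer group\<close>

lemma pruefer_group_pow: "x [^]\<^bsub>pruefer_group p\<^esub> (n::nat) = x ^ n"
  by (induction n) (simp_all add: pruefer_group_def mult.commute)

lemma pruefer_order_dvd_iff:
  assumes "prime p" "z \<in> carrier (pruefer_group p)"
  shows "pruefer_order p z dvd n \<longleftrightarrow> z ^ n = 1"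
  using group.pow_eq_id[OF pruefer_group_group[OF assms(1)] assms(2), of n]
  by (simp add: pruefer_order_def pruefer_group_pow) (simp add: pruefer_group_def)

lemma pruefer_order_prime_power:
  assumes p: "prime p" and z: "z ^ (p ^ k) = 1"
  obtains m where "m \<le> k" "pruefer_order p z = p ^ m" "z ^ (p ^ m) = 1"
proof -
  have zc: "z \<in> carrier (pruefer_group p)"
    using z by (auto simp: pruefer_group_def)
  have "pruefer_order p z dvd p ^ k"
    using pruefer_order_dvd_iff[OF p zc] z by simp
  then obtain m where m: "m \<le> k" "pruefer_order p z = p ^ m"
    using divides_primepow_nat[OF p] by auto
  then show ?thesis
    using that pruefer_order_dvd_iff[OF p zc, of "p ^ m"] by simp
qed

text \<open>The exponent in \<open>pruefer_power\<close> stops at the order \<open>p ^ m\<close> of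
  \<open>z\<close>; the digits between \<open>m\<close> and \<open>k\<close> change it only by a
  multiple of \<open>p ^ m\<close>. So one truncation at \<open>k\<close> serves all these roots at
  once, whatever their orders.\<close>

lemma pruefer_power_eq_residue:
  assumes p: "prime p" and z: "z ^ (p ^ k) = 1"
  shows "pruefer_power p z x = z ^ padic_residue p k x"
proof -
  obtain m where m: "m \<le> k" "pruefer_order p z = p ^ m" "z ^ (p ^ m) = 1"
    using pruefer_order_prime_power[OF p z] .
  have "(THE j. pruefer_order p z = p ^ j) = m"
    using m(2) prime_gt_1_nat[OF p] by (intro the_equality) auto
  then have "pruefer_power p z x = z ^ padic_residue p m x"
    by (simp add: pruefer_power_def padic_residue_def)
  then show ?thesis
    using padic_residue_cong[OF m(1), of p x] m(3) by (auto simp: power_add power_mult)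
qed

section \<open>Convergence of the weighted series over the Pruefer group\<close>

text \<open>With \<open>q = p ^ Suc k\<close>, at most \<open>q\<close> roots are new at level
  \<open>Suc k\<close>, each of order exactly \<open>q\<close>, so they add at most
  \<open>1 / q ^ 2\<close>. The right side is shaped to telescope: it grows by
  \<open>(p - 1) / q\<close>, which is enough as \<open>p\<close> is at least 2.\<close>

lemma sum_inverse_cube_order_le:
  assumes p: "prime p"
  shows "(\<Sum>z | z ^ (p ^ k) = 1. 1 / real (pruefer_order p z) ^ 3) \<le> 2 - 1 / real p ^ k"
proof (induction k)
  case 0
  have "pruefer_order p 1 = 1"
    using pruefer_order_prime_power[OF p, of 1 0] by auto
  then show ?case by simp
next
  case (Suc k)
  let ?R = "\<lambda>k. {z::complex. z ^ (p ^ k) = 1}" and ?q = "real p ^ Suc k"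
  have p2: "p \<ge> 2"
    using prime_ge_2_nat[OF p] .
  have fin: "finite (?R j)" for j
    using p2 by (intro finite_roots_unity) simp
  have sub: "?R k \<subseteq> ?R (Suc k)"
    by (auto simp: power_mult mult.commute[of p])
  have ord: "pruefer_order p z = p ^ Suc k" if z: "z \<in> ?R (Suc k) - ?R k" for z
  proof -
    obtain m where m: "m \<le> Suc k" "pruefer_order p z = p ^ m" "z ^ (p ^ m) = 1"
      using pruefer_order_prime_power[OF p, of z "Suc k"] z by auto
    have "m \<noteq> j" if "j \<le> k" for j
    proof
      assume "m = j"
      then have "p ^ m dvd p ^ k"
        using that by (simp add: le_imp_power_dvd)
      then have "z ^ (p ^ k) = 1"
        using m(3) by (metis dvdE power_mult power_one)
      then show False using z by simp
    qed
    then show ?thesis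
      using m by (metis le_Suc_eq)
  qed
  have "(\<Sum>z\<in>?R (Suc k) - ?R k. 1 / real (pruefer_order p z) ^ 3)
      = real (card (?R (Suc k) - ?R k)) * (1 / ?q ^ 3)"
    using ord by simp
  also have "\<dots> \<le> ?q * (1 / ?q ^ 3)"
  proof (intro mult_right_mono)
    have "card (?R (Suc k) - ?R k) \<le> card (?R (Suc k))"
      by (intro card_mono fin) auto
    also have "\<dots> = p ^ Suc k"
      using p2 by (intro card_roots_unity_eq) simp
    finally show "real (card (?R (Suc k) - ?R k)) \<le> ?q"
      by (metis of_nat_le_iff of_nat_power)
  qed simp
  also have "\<dots> = 1 / ?q * (1 / ?q)"
    using p2 by (simp add: power3_eq_cube)
  also have "\<dots> \<le> 1 / ?q * (real p - 1)"
  proof (intro mult_left_mono)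
    have "1 / ?q \<le> 1"
      using p2 one_le_power[of "real p" "Suc k"] by simp
    then show "1 / ?q \<le> real p - 1"
      using p2 by linarith
  qed simp
  also have "\<dots> = 1 / real p ^ k - 1 / ?q"
    using p2 by (simp add: field_simps)
  finally have "(\<Sum>z\<in>?R (Suc k) - ?R k. 1 / real (pruefer_order p z) ^ 3)
      \<le> 1 / real p ^ k - 1 / ?q" .
  then show ?case
    using Suc sum.subset_diff[OF sub fin, of "\<lambda>z. 1 / real (pruefer_order p z) ^ 3"] by linarith
qed

text \<open>The group is an increasing union of finite levels; adding the exponents of two levels
  gives one that contains both.\<close>

lemma finite_subset_pruefer_group:
  assumes p: "prime p" and "finite F" "F \<subseteq> carrier (pruefer_group p)"
  shows "\<exists>k. F \<subseteq> {z. z ^ (p ^ k) = 1}"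
  using assms(2,3)
proof (induction F)
  case (insert x F)
  then obtain k m where k: "F \<subseteq> {z. z ^ (p ^ k) = 1}" and m: "x ^ (p ^ m) = 1"
    by (auto simp: pruefer_group_def)
  have "F \<subseteq> {z. z ^ (p ^ (k + m)) = 1}"
    using k by (auto simp: power_add power_mult)
  moreover have "x ^ (p ^ (k + m)) = 1"
    using m by (simp add: add.commute[of k m] power_add power_mult)
  ultimately show ?case
    by (intro exI[of _ "k + m"]) simp
qed simp

text \<open>An \<open>infsum\<close> that does not converge has the default value 0, so summability
  is needed before the series can dominate its finite partial sums.\<close>

lemma summable_on_pruefer_group:
  assumes p: "prime p" and A: "A \<subseteq> carrier (pruefer_group p)"
    and b: "\<And>z. z \<in> A \<Longrightarrow> 0 \<le> b z \<and> b z \<le> 1"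
  shows "(\<lambda>z. 1 / real (pruefer_order p z) ^ 3 * b z) summable_on A"
proof (rule nonneg_bdd_above_summable_on)
  show "bdd_above (sum (\<lambda>z. 1 / real (pruefer_order p z) ^ 3 * b z) ` {F. F \<subseteq> A \<and> finite F})"
  proof (rule bdd_aboveI2[where M = 2])
    fix F assume "F \<in> {F. F \<subseteq> A \<and> finite F}"
    then have F: "F \<subseteq> A" "finite F" by auto
    then obtain k where k: "F \<subseteq> {z. z ^ (p ^ k) = 1}"
      using finite_subset_pruefer_group[OF p, of F] A by blast
    have "(\<Sum>z\<in>F. 1 / real (pruefer_order p z) ^ 3 * b z)
        \<le> (\<Sum>z\<in>F. 1 / real (pruefer_order p z) ^ 3)"
      using b F by (intro sum_mono mult_left_le) auto
    also have "\<dots> \<le> (\<Sum>z | z ^ (p ^ k) = 1. 1 / real (pruefer_order p z) ^ 3)"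
      using prime_gt_0_nat[OF p] by (intro sum_mono2 k finite_roots_unity) auto
    also have "\<dots> \<le> 2 - 1 / real p ^ k"
      by (rule sum_inverse_cube_order_le[OF p])
    also have "\<dots> \<le> 2" by simp
    finally show "(\<Sum>z\<in>F. 1 / real (pruefer_order p z) ^ 3 * b z) \<le> 2" .
  qed
qed (use b in auto)

section \<open>Local discrepancies\<close>

text \<open>Orthogonality: summing \<open>z ^ (t n - r)\<close> over the roots gives
  \<open>q\<close> if \<open>t n = r\<close> and 0 otherwise. The exponent \<open>q - r\<close>
  replaces \<open>- r\<close> to stay in the naturals, and the root 1 accounts for the subtracted
  1.\<close>

lemma residue_count_fourier:
  fixes t :: "nat \<Rightarrow> nat"
  assumes q: "q > 0" and r: "r < q" and t: "\<And>n. n \<in> {1..N} \<Longrightarrow> t n < q" and N: "N \<ge> 1"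
  shows "complex_of_real (real q * (real (card {n \<in> {1..N}. t n = r}) / real N) - 1)
    = (\<Sum>z\<in>{z. z ^ q = 1} - {1}. z ^ (q - r) * (1 / of_nat N * (\<Sum>n = 1..N. z ^ t n)))"
proof -
  let ?f = "\<lambda>z::complex. z ^ (q - r) * (1 / of_nat N * (\<Sum>n = 1..N. z ^ t n))"
  have dvd: "q dvd t n + (q - r) \<longleftrightarrow> t n = r" if n: "n \<in> {1..N}" for n
  proof
    assume "q dvd t n + (q - r)"
    then have "int q dvd int (t n + (q - r)) - int q"
      by (metis dvd_diff dvd_refl of_nat_dvd_iff)
    then have "int q dvd int (t n) - int r"
      using r by (simp add: of_nat_diff algebra_simps)
    then have "int (t n) mod int q = int r mod int q"
      by (simp add: mod_eq_dvd_iff)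
    then show "t n = r"
      using t[OF n] r by simp
  qed (use r in simp)
  have "(\<Sum>z | z ^ q = 1. ?f z) = (\<Sum>z | z ^ q = 1. \<Sum>n = 1..N. 1 / of_nat N * z ^ (t n + (q - r)))"
    by (simp add: sum_distrib_left power_add mult_ac)
  also have "\<dots> = (\<Sum>n = 1..N. 1 / of_nat N * (\<Sum>z | z ^ q = 1. z ^ (t n + (q - r))))"
    by (subst sum.swap) (simp add: sum_distrib_left)
  also have "\<dots> = (\<Sum>n = 1..N. if t n = r then of_nat q / of_nat N else 0)"
    using dvd by (intro sum.cong) (auto simp: sum_roots_unity_power[OF q])
  also have "\<dots> = (\<Sum>n \<in> {n \<in> {1..N}. t n = r}. of_nat q / of_nat N)"
    by (rule sum.inter_filter[symmetric]) simp
  also have "\<dots> = of_nat (card {n \<in> {1..N}. t n = r}) * (of_nat q / of_nat N)"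
    by (rule sum_constant)
  finally have all: "(\<Sum>z | z ^ q = 1. ?f z)
      = of_nat (card {n \<in> {1..N}. t n = r}) * (of_nat q / of_nat N)" .
  have one: "?f 1 = 1"
    using N by simp
  have split: "(\<Sum>z | z ^ q = 1. ?f z) = ?f 1 + (\<Sum>z\<in>{z. z ^ q = 1} - {1}. ?f z)"
    using q by (intro sum.remove finite_roots_unity) auto
  have "(\<Sum>z\<in>{z. z ^ q = 1} - {1}. ?f z)
      = of_nat (card {n \<in> {1..N}. t n = r}) * (of_nat q / of_nat N) - 1"
    using split unfolding all one by (simp only: add_diff_cancel_left')
  then show ?thesis
    by (simp add: mult.commute)
qed

text \<open>The Fourier identity bounds \<open>p ^ k\<close> times the deviation by a sum of moduli
  \<open>S z\<close>, and Cauchy-Schwarz bounds that sum by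
  \<open>(p ^ k)\<^sup>2 * sqrt ?T\<close>.\<close>

lemma local_discrepancy_le:
  fixes \<alpha> :: "nat \<Rightarrow> (nat \<Rightarrow> rat) set" and p N :: nat
  defines "b \<equiv> \<lambda>z. (cmod (1 / of_nat N * (\<Sum>n = 1..N. pruefer_power p z (\<alpha> n))))\<^sup>2"
  assumes p: "prime p" and N: "N \<ge> 1" and \<alpha>: "\<And>n. n \<in> {1..N} \<Longrightarrow> \<alpha> n \<in> padic_ints p"
    and r: "r < p ^ k"
  shows "\<bar>real (card {n \<in> {1..N}. padic_residue p k (\<alpha> n) = r}) / real N - 1 / real p ^ k\<bar>
    \<le> real p ^ k * sqrt (\<Sum>\<^sub>\<infinity>z \<in> carrier (pruefer_group p) - {1}.
        1 / real (pruefer_order p z) ^ 3 * b z)"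
    (is "\<bar>?c / _ - _\<bar> \<le> _ * sqrt ?T")
proof -
  define q where "q = p ^ k"
  define A where "A = {z::complex. z ^ q = 1} - {1}"
  define S where "S z = cmod (1 / of_nat N * (\<Sum>n = 1..N. pruefer_power p z (\<alpha> n)))" for z
  have q: "q > 0"
    using prime_gt_0_nat[OF p] by (simp add: q_def)
  have fin: "finite A"
    using q by (simp add: A_def finite_roots_unity)
  have cardA: "card A \<le> q"
    using q card_roots_unity_eq[of q] by (simp add: A_def card_Diff_subset_Int finite_roots_unity)
  have zk: "z ^ (p ^ k) = 1" if "z \<in> A" for z
    using that by (simp add: A_def q_def)
  have norm1: "cmod z = 1" if z: "z \<in> carrier (pruefer_group p)" for z
  proof -
    obtain m where "z ^ (p ^ m) = 1"
      using z by (auto simp: pruefer_group_def)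
    then have "cmod z ^ (p ^ m) = 1 ^ (p ^ m)"
      by (metis norm_one norm_power power_one)
    then show ?thesis
      by (rule power_eq_imp_eq_base) (simp_all add: prime_gt_0_nat[OF p])
  qed
  \<comment> \<open>The upper bound serves the summability of the series.\<close>
  have b01: "0 \<le> b z \<and> b z \<le> 1" if "z \<in> carrier (pruefer_group p) - {1}" for z
  proof -
    have "cmod (\<Sum>n = 1..N. pruefer_power p z (\<alpha> n)) \<le> real N"
      using norm1[of z] that
      by (intro order_trans[OF norm_sum]) (simp add: pruefer_power_def norm_power)
    then have "S z \<le> 1"
      using N by (simp add: S_def norm_mult norm_divide)
    then show ?thesis
      by (simp add: b_def S_def[symmetric] power_le_one S_def)
  qed
  have sumb: "(\<Sum>z\<in>A. 1 / real (pruefer_order p z) ^ 3 * b z) \<le> ?T"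
    using zk by (intro finite_sum_le_infsum summable_on_pruefer_group[OF p] b01 fin)
      (auto simp: A_def b_def pruefer_group_def)
  \<comment> \<open>Inserting the weight costs at most \<open>q ^ 3\<close>, because the order of a
    root in \<open>A\<close> is at most \<open>q\<close>.\<close>
  have bq: "b z \<le> real q ^ 3 * (1 / real (pruefer_order p z) ^ 3 * b z)" if z: "z \<in> A" for z
  proof -
    obtain m where m: "m \<le> k" "pruefer_order p z = p ^ m"
      using pruefer_order_prime_power[OF p zk[OF z]] .
    have "0 < pruefer_order p z" "pruefer_order p z \<le> q"
      using m prime_gt_0_nat[OF p] by (auto simp: q_def intro: power_increasing)
    then have "1 \<le> real q ^ 3 / real (pruefer_order p z) ^ 3"
      by (simp add: power_mono)
    then have "1 * b z \<le> real q ^ 3 / real (pruefer_order p z) ^ 3 * b z"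
      by (intro mult_right_mono) (simp_all add: b_def)
    then show ?thesis by simp
  qed
  have "\<bar>real q * (?c / real N) - 1\<bar>
      = cmod (\<Sum>z\<in>A. z ^ (q - r) * (1 / of_nat N * (\<Sum>n = 1..N. z ^ padic_residue p k (\<alpha> n))))"
    unfolding A_def
    using padic_residue_less[OF p \<alpha>, of _ k] N r
    by (subst residue_count_fourier[OF q, symmetric])
      (simp_all only: q_def norm_of_real real_norm_def)
  also have "\<dots> \<le> (\<Sum>z\<in>A. S z)"
  proof (intro order_trans[OF norm_sum] sum_mono)
    fix z assume z: "z \<in> A"
    have "z \<in> carrier (pruefer_group p)"
      using zk[OF z] by (auto simp: pruefer_group_def)
    then have "cmod z = 1"
      by (rule norm1)
    then show "cmod (z ^ (q - r) * (1 / of_nat N * (\<Sum>n = 1..N. z ^ padic_residue p k (\<alpha> n)))) \<le> S z"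
      by (simp add: S_def pruefer_power_eq_residue[OF p zk[OF z]] norm_mult norm_divide norm_power)
  qed
  finally have fourier: "\<bar>real q * (?c / real N) - 1\<bar> \<le> (\<Sum>z\<in>A. S z)" .
  \<comment> \<open>Cauchy-Schwarz: one factor \<open>q\<close> comes from the number of roots and
    \<open>q ^ 3\<close> from the weights.\<close>
  have "(\<Sum>z\<in>A. S z)\<^sup>2 \<le> real (card A) * (\<Sum>z\<in>A. b z)"
    using sum_squared_le_sum_of_squares[of S A] by (simp add: b_def S_def mult.commute)
  also have "\<dots> \<le> real q * (\<Sum>z\<in>A. real q ^ 3 * (1 / real (pruefer_order p z) ^ 3 * b z))"
    using cardA bq by (intro mult_mono sum_mono) (auto simp: b_def sum_nonneg)
  also have "\<dots> = real q ^ 4 * (\<Sum>z\<in>A. 1 / real (pruefer_order p z) ^ 3 * b z)"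
    by (simp add: sum_distrib_left power4_eq_xxxx power3_eq_cube mult_ac)
  also have "\<dots> \<le> real q ^ 4 * ?T"
    using sumb by (intro mult_left_mono) auto
  finally have "(\<Sum>z\<in>A. S z) \<le> sqrt (real q ^ 4 * ?T)"
    by (rule real_le_rsqrt)
  also have "\<dots> = real q * (real q * sqrt ?T)"
    by (simp add: real_sqrt_mult real_sqrt_power[of _ 4] power4_eq_xxxx)
  finally have "\<bar>real q * (?c / real N) - 1\<bar> \<le> real q * (real q * sqrt ?T)"
    using fourier by simp
  moreover have "\<bar>real q * (?c / real N) - 1\<bar> = real q * \<bar>?c / real N - 1 / real q\<bar>"
  proof -
    have "real q * (?c / real N) - 1 = real q * (?c / real N - 1 / real q)"
      using q by (simp add: right_diff_distrib)
    then show ?thesis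
      by (simp only: abs_mult abs_of_nat)
  qed
  ultimately show ?thesis
    using q by (simp add: q_def)
qed

section \<open>Choice of the critical radius and passage to smaller discs\<close>

text \<open>The exponent \<open>k\<close> is one below the least \<open>m\<close> with
  \<open>y < x ^ m\<close>; the hypothesis on \<open>y\<close> excludes
  \<open>m = 0\<close>.\<close>

lemma exists_power_bracket:
  fixes x y :: real
  assumes "x > 1" "y \<ge> 1"
  shows "\<exists>k::nat. x ^ k \<le> y \<and> y < x ^ Suc k"
proof -
  obtain n where n: "y < x ^ n"
    using real_arch_pow[OF assms(1)] by blast
  define m where "m = (LEAST n. y < x ^ n)"
  have m: "y < x ^ m"
    unfolding m_def using n by (rule LeastI)
  then obtain k where k: "m = Suc k"
    using assms(2) by (cases m) auto
  have "x ^ k \<le> y"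
    using not_less_Least[of k "\<lambda>n. y < x ^ n"] k m_def by force
  then show ?thesis
    using m k by blast
qed

text \<open>The bound \<open>dev\<close> worsens as \<open>k\<close> grows, so it is used only while
  \<open>P ^ k\<close> is at most \<open>1 / u\<close> with \<open>u = T powr (1 / 4)\<close>, where
  it gives \<open>u\<close>. Beyond that level monotonicity of \<open>c\<close> takes over.\<close>

lemma decreasing_frequency_deviation_le:
  fixes c :: "nat \<Rightarrow> real"
  assumes P: "P > 1" and T: "T \<ge> 0" and c: "\<And>k. 0 \<le> c k" "\<And>k. c k \<le> 1" and dec: "decseq c"
    and dev: "\<And>k. \<bar>c k - 1 / P ^ k\<bar> \<le> P ^ k * sqrt T"
  shows "\<bar>c k - 1 / P ^ k\<bar> \<le> (P + 1) * T powr (1 / 4)"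
proof -
  define u where "u = T powr (1 / 4)"
  have u0: "u \<ge> 0"
    by (simp add: u_def)
  have "u * u = T powr (1 / 2)"
    by (simp add: u_def flip: powr_add)
  then have uu: "sqrt T = u * u"
    using T by (simp add: powr_half_sqrt)
  have pk: "0 < 1 / P ^ k" "1 / P ^ k \<le> 1"
    using P by auto
  consider "u = 0" | "u \<ge> 1" | "0 < u" "u < 1"
    using u0 by linarith
  then show ?thesis
    unfolding u_def[symmetric]
  proof cases
    case 1
    then show "\<bar>c k - 1 / P ^ k\<bar> \<le> (P + 1) * u"
      using dev[of k] uu by simp
  next
    case 2
    \<comment> \<open>Here the claim is trivial: two numbers in the unit interval differ by at most
      1.\<close>
    then have "1 * 1 \<le> (P + 1) * u"
      using P by (intro mult_mono) auto
    then show "\<bar>c k - 1 / P ^ k\<bar> \<le> (P + 1) * u"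
      using c[of k] pk by linarith
  next
    case 3
    \<comment> \<open>The last level at which \<open>P ^ j * sqrt T\<close> is still at most
      \<open>u\<close>; its maximality makes \<open>1 / P ^ j\<close> at most
      \<open>P * u\<close>.\<close>
    obtain j where j: "P ^ j \<le> 1 / u" "1 / u < P ^ Suc j"
      using exists_power_bracket[OF P, of "1 / u"] 3 by auto
    have small: "\<bar>c i - 1 / P ^ i\<bar> \<le> u" if "i \<le> j" for i
    proof -
      have "P ^ i \<le> 1 / u"
        using j(1) power_increasing[OF that, of P] P by linarith
      then have "P ^ i * (u * u) \<le> 1 / u * (u * u)"
        using 3 by (intro mult_right_mono) auto
      also have "\<dots> = u"
        using 3 by simp
      finally show ?thesis
        using dev[of i] unfolding uu by linarith
    qed
    have Pu: "P * u \<ge> 0"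
      using P u0 by simp
    show "\<bar>c k - 1 / P ^ k\<bar> \<le> (P + 1) * u"
    proof (cases "k \<le> j")
      case True
      then show ?thesis
        using small[of k] Pu by (simp add: distrib_right)
    next
      case False
      \<comment> \<open>Since \<open>c j\<close> is at most \<open>u + 1 / P ^ j\<close>, both
        \<open>c k\<close> and \<open>1 / P ^ k\<close> lie between 0 and
        \<open>(P + 1) * u\<close>, hence so does their distance.\<close>
      have "1 / P ^ j \<le> P * u"
        using j(2) 3 P by (simp add: field_simps)
      moreover have "c k \<le> c j"
        using dec False by (simp add: decseq_def)
      moreover have "1 / P ^ k \<le> 1 / P ^ j"
        using P False by (intro divide_left_mono power_increasing) auto
      ultimately show ?thesis
        using small[of j] c(1)[of k] pk u0 unfolding distrib_right by linarith
    qed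
  qed
qed

theorem mainTheorem1:
  fixes p :: nat
  assumes "prime p"
  shows "\<exists>C :: real. C > 0 \<and>
    (\<forall>N \<ge> 1. \<forall>\<alpha> :: nat \<Rightarrow> (nat \<Rightarrow> rat) set.
      (\<forall>n \<in> {1..N}. \<alpha> n \<in> padic_ints p) \<longrightarrow>
      padic_discrepancy p N \<alpha> \<le>
        C * (\<Sum>\<^sub>\<infinity>\<zeta> \<in> carrier (pruefer_group p) - {1}.
               1 / real (pruefer_order p \<zeta>) ^ 3 *
               (cmod (1 / of_nat N * (\<Sum>n = 1..N. pruefer_power p \<zeta> (\<alpha> n))))\<^sup>2)
            powr (1 / 4))"
proof (intro exI[of _ "real p + 1"] conjI allI impI)
  show "real p + 1 > 0"
    by simp
  fix N :: nat and \<alpha> :: "nat \<Rightarrow> (nat \<Rightarrow> rat) set"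
  assume N: "N \<ge> 1" and "\<forall>n \<in> {1..N}. \<alpha> n \<in> padic_ints p"
  then have \<alpha>: "\<And>n. n \<in> {1..N} \<Longrightarrow> \<alpha> n \<in> padic_ints p"
    by blast
  define T where "T = (\<Sum>\<^sub>\<infinity>\<zeta> \<in> carrier (pruefer_group p) - {1}.
    1 / real (pruefer_order p \<zeta>) ^ 3 *
    (cmod (1 / of_nat N * (\<Sum>n = 1..N. pruefer_power p \<zeta> (\<alpha> n))))\<^sup>2)"
  have "\<bar>real (card {n \<in> {1..N}. \<alpha> n \<in> padic_disc p a (1 / real p ^ k)}) / real N - 1 / real p ^ k\<bar>
      \<le> (real p + 1) * T powr (1 / 4)" if a: "a \<in> padic_ints p" for a k
  proof -
    define A where "A k = {n \<in> {1..N}. padic_residue p k (\<alpha> n) = padic_residue p k a}" for k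
    have "decseq (\<lambda>k. real (card (A k)) / real N)"
    proof (intro decseq_SucI divide_right_mono of_nat_mono card_mono)
      show "A (Suc k) \<subseteq> A k" for k
        using padic_residue_eq_mono[OF assms \<alpha> a, of _ k "Suc k"] by (auto simp: A_def)
    qed (auto simp: A_def)
    moreover have "real (card (A k)) / real N \<le> 1" for k
    proof -
      have "card (A k) \<le> card {1..N}"
        by (intro card_mono) (auto simp: A_def)
      then show ?thesis
        using N by simp
    qed
    moreover have "\<bar>real (card (A k)) / real N - 1 / real p ^ k\<bar> \<le> real p ^ k * sqrt T" for k
      unfolding A_def T_def
      by (rule local_discrepancy_le[OF assms N \<alpha> padic_residue_less[OF assms a]])
    moreover have "T \<ge> 0"
      unfolding T_def by (intro infsum_nonneg) simp
    moreover have "real p > 1"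
      using prime_gt_1_nat[OF assms] by simp
    ultimately have "\<bar>real (card (A k)) / real N - 1 / real p ^ k\<bar> \<le> (real p + 1) * T powr (1 / 4)"
      by (intro decreasing_frequency_deviation_le) auto
    moreover have "{n \<in> {1..N}. \<alpha> n \<in> padic_disc p a (1 / real p ^ k)} = A k"
      using padic_disc_iff_residue[OF assms \<alpha> a] by (auto simp: A_def)
    ultimately show ?thesis by simp
  qed
  \<comment> \<open>Bounding a real supremum by \<open>cSUP_least\<close> requires a nonempty index
    set; \<open>N \<ge> 1\<close> supplies the point \<open>\<alpha> 1\<close>.\<close>
  moreover have "padic_ints p \<noteq> {}"
    using \<alpha>[of 1] N by auto
  ultimately have "padic_discrepancy p N \<alpha> \<le> (real p + 1) * T powr (1 / 4)"
    unfolding padic_discrepancy_def by (intro cSUP_least) auto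
  then show "padic_discrepancy p N \<alpha> \<le> (real p + 1) * (\<Sum>\<^sub>\<infinity>\<zeta> \<in> carrier (pruefer_group p) - {1}.
      1 / real (pruefer_order p \<zeta>) ^ 3 *
      (cmod (1 / of_nat N * (\<Sum>n = 1..N. pruefer_power p \<zeta> (\<alpha> n))))\<^sup>2) powr (1 / 4)"
    by (simp only: T_def)
qed

end
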